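(* (In classical mathematics.) Let $A$ be a commutative ring and $\ell\geq 1$ an integer. The Krull dimension of $A$ is $\geq\ell$ if and only if there exists a pseudo regular sequence of length $\ell$ in $A$.
   Context: Rings are commutative with unit. The Krull dimension of $A$ is $\ge\ell$ if there is a strictly increasing chain of $\ell+1$ prime ideals of $A$. A sequence $(x_1,\ldots,x_\ell)$ of elements of $A$ is called pseudo regular if for all $a_1,\ldots,a_\ell\in A$ and all $m_1,\ldots,m_\ell\in\mathbb{N}$ (with $0\in\mathbb N$) one has $$x_1^{m_1}\bigl(x_2^{m_2}\cdots\bigl(x_\ell^{m_\ell}(1+a_\ell x_\ell)+\cdots+a_2x_2\bigr)+a_1x_1\bigr)\neq 0,$$ that is, $$x_1^{m_1}\cdots x_\ell^{m_\ell}+a_\ell x_1^{m_1}\cdots x_{\ell-1}^{m_{\ell-1}}x_\ell^{1+m_\ell}+\cdots+a_2x_1^{m_1}x_2^{1+m_2}+a_1x_1^{1+m_1}\neq 0.$$ *)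

theory Defs
  imports "HOL-Algebra.Ideal"
begin

definition krull_dim_ge :: "('a, 'b) ring_scheme \<Rightarrow> nat \<Rightarrow> bool" where
  "krull_dim_ge R l \<longleftrightarrow>
     (\<exists>P :: nat \<Rightarrow> 'a set. (\<forall>i\<le>l. primeideal (P i) R) \<and> (\<forall>i<l. P i \<subset> P (Suc i)))"

text \<open>
  The argument lists are the sequences of the \<open>x\<close>, the exponents \<open>m\<close> and the coefficients
  \<open>a\<close>, in this order. They are only used with equal lengths, for which the equations give
  \<open>x1^m1 (x2^m2 (... xl^ml (1 + al xl) ... + a2 x2) + a1 x1)\<close>.
\<close>
fun pseudo_regular_expr ::
  "('a, 'b) ring_scheme \<Rightarrow> 'a list \<Rightarrow> nat list \<Rightarrow> 'a list \<Rightarrow> 'a" where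
  "pseudo_regular_expr R (x # xs) (m # ms) (a # as) =
     (x [^]\<^bsub>R\<^esub> m) \<otimes>\<^bsub>R\<^esub> (pseudo_regular_expr R xs ms as \<oplus>\<^bsub>R\<^esub> a \<otimes>\<^bsub>R\<^esub> x)"
| "pseudo_regular_expr R _ _ _ = \<one>\<^bsub>R\<^esub>"

definition pseudo_regular :: "('a, 'b) ring_scheme \<Rightarrow> 'a list \<Rightarrow> bool" where
  "pseudo_regular R xs \<longleftrightarrow>
     set xs \<subseteq> carrier R \<and>
     (\<forall>as ms. length as = length xs \<and> set as \<subseteq> carrier R \<and> length ms = length xs \<longrightarrow>
        pseudo_regular_expr R xs ms as \<noteq> \<zero>\<^bsub>R\<^esub>)"

end

theory Submission
  imports Defs "HOL-Algebra.Ring_Divisibility"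
begin

text \<open>
  For a sequence \<open>x1, \<dots>, xl\<close>, let \<open>S_i\<close> be the set of the values of the nested expression of the
  tail \<open>x(i+1), \<dots>, xl\<close>, over all exponents and coefficients. Then \<open>S_l = {1}\<close> and
  \<open>S_(i-1) = xi^\<nat> (S_i + xi A)\<close>; each \<open>S_i\<close> is a multiplicative monoid, and pseudo regularity says
  that \<open>0 \<notin> S_0\<close>. Two remarks about one step of this recursion give the theorem.

  If \<open>P \<subset> Q\<close> are ideals, \<open>P\<close> is prime, \<open>x \<in> Q - P\<close> and \<open>Q\<close> misses \<open>S\<close>, then \<open>P\<close> misses
  \<open>x^\<nat> (S + x A)\<close>: modulo \<open>Q\<close> the second factor is an element of \<open>S\<close>, so it is not in \<open>Q\<close>, hence
  not in \<open>P\<close>, and by primality neither is its product with a power of \<open>x\<close>. Starting from the top of a chain \<open>P_0 \<subset> \<dots> \<subset> P_l\<close> and picking \<open>xi \<in> P_i - P_(i-1)\<close>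
  one obtains a pseudo regular sequence (\<open>boundary_monoid_disjoint_chain\<close>).

  Conversely, if an ideal \<open>P\<close> misses \<open>x^\<nat> (S + x A)\<close>, then \<open>x \<notin> P\<close> and \<open>P + x A\<close> misses \<open>S\<close>. An
  ideal that misses a multiplicative monoid can be enlarged to a prime ideal that still misses it
  (\<open>prime_ideal_avoiding\<close>, where Zorn's lemma enters). Starting from the zero ideal and \<open>S_0\<close>,
  alternating these two steps yields primes \<open>P_i\<close> missing \<open>S_i\<close> with \<open>P_(i-1) + xi A \<subseteq> P_i\<close>, and
  the inclusions are strict because of the \<open>xi\<close> (\<open>prime_chain_of_disjoint\<close>).
\<close>

section \<open>Prime ideals avoiding a multiplicative monoid\<close>

lemma (in cring) mem_add_PIdl:
  assumes "y \<in> M <+>\<^bsub>R\<^esub> PIdl a"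
  obtains m r where "m \<in> M" "r \<in> carrier R" "y = m \<oplus> r \<otimes> a"
  using assms unfolding set_add_def' cgenideal_def by auto

lemma (in cring) subset_add_PIdl:
  assumes "ideal M R" "a \<in> carrier R"
  shows "M \<subseteq> M <+>\<^bsub>R\<^esub> PIdl a" "a \<in> M <+>\<^bsub>R\<^esub> PIdl a"
proof -
  have "Idl (M \<union> PIdl a) = M <+>\<^bsub>R\<^esub> PIdl a"
    using assms by (intro union_genideal cgenideal_ideal)
  moreover have "M \<union> PIdl a \<subseteq> carrier R"
    using assms by (meson Un_least additive_subgroup.a_subset cgenideal_ideal ideal.axioms(1))
  ultimately have "M \<union> PIdl a \<subseteq> M <+>\<^bsub>R\<^esub> PIdl a"
    using genideal_self by metis
  then show "M \<subseteq> M <+>\<^bsub>R\<^esub> PIdl a" "a \<in> M <+>\<^bsub>R\<^esub> PIdl a"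
    using cgenideal_self[OF assms(2)] by auto
qed

text \<open>
  An ideal that is maximal among those containing \<open>I\<close> and missing \<open>S\<close> is prime: if neither \<open>a\<close> nor
  \<open>b\<close> belongs to it, then adjoining either of them produces an element of \<open>S\<close>, and the product of
  these two elements is in \<open>S\<close> and, modulo \<open>M\<close>, a multiple of \<open>a b\<close>.
\<close>
lemma (in cring) prime_ideal_avoiding:
  assumes I: "ideal I R" and S: "submonoid S R" and IS: "I \<inter> S = {}"
  obtains P where "primeideal P R" "I \<subseteq> P" "P \<inter> S = {}"
proof -
  define F where "F = {J. ideal J R \<and> I \<subseteq> J \<and> J \<inter> S = {}}"
  interpret S: submonoid S R by (fact S)
  have "\<exists>M\<in>F. \<forall>X\<in>F. M \<subseteq> X \<longrightarrow> X = M"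
  proof (rule subset_Zorn_nonempty)
    show "F \<noteq> {}"
      using I IS by (auto simp: F_def)
    fix C assume C: "C \<noteq> {}" "subset.chain F C"
    then have "subset.chain {J. ideal J R} C"
      by (auto simp: pred_on.chain_def F_def)
    from chain_Union_is_ideal[OF this] C show "\<Union>C \<in> F"
      by (auto simp: pred_on.chain_def F_def; fastforce)
  qed
  then obtain M where "M \<in> F" and max: "\<And>X. X \<in> F \<Longrightarrow> M \<subseteq> X \<Longrightarrow> X = M"
    by blast
  then have M: "ideal M R" "I \<subseteq> M" "M \<inter> S = {}"
    by (auto simp: F_def)
  interpret M: ideal M R by (fact M(1))
  have meets: "\<exists>m\<in>M. \<exists>r\<in>carrier R. m \<oplus> r \<otimes> a \<in> S" if "a \<in> carrier R" "a \<notin> M" for a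
  proof (rule ccontr)
    assume "\<not> ?thesis"
    then have "(M <+>\<^bsub>R\<^esub> PIdl a) \<inter> S = {}"
      by (blast elim: mem_add_PIdl)
    moreover have "ideal (M <+>\<^bsub>R\<^esub> PIdl a) R"
      using that M(1) by (intro add_ideals cgenideal_ideal)
    ultimately have "M <+>\<^bsub>R\<^esub> PIdl a \<in> F"
      using subset_add_PIdl[OF M(1) that(1)] M(2) by (auto simp: F_def)
    then show False
      using max subset_add_PIdl[OF M(1) that(1)] that(2) by blast
  qed
  have "primeideal M R"
  proof (rule primeidealI[OF M(1) is_cring])
    show "carrier R \<noteq> M"
      using M(3) S.one_closed by blast
    fix a b assume ab: "a \<in> carrier R" "b \<in> carrier R" "a \<otimes> b \<in> M"
    show "a \<in> M \<or> b \<in> M"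
    proof (rule ccontr)
      assume "\<not> ?thesis"
      then obtain m r n q where *: "m \<in> M" "r \<in> carrier R" "m \<oplus> r \<otimes> a \<in> S"
        "n \<in> M" "q \<in> carrier R" "n \<oplus> q \<otimes> b \<in> S"
        using meets ab by meson
      have mn: "m \<in> carrier R" "n \<in> carrier R"
        using * M.Icarr by auto
      have "(m \<oplus> r \<otimes> a) \<otimes> (n \<oplus> q \<otimes> b)
        = m \<otimes> (n \<oplus> q \<otimes> b) \<oplus> (n \<otimes> (r \<otimes> a) \<oplus> (a \<otimes> b) \<otimes> (r \<otimes> q))"
        using mn *(2,5) ab(1,2) by algebra
      also have "\<dots> \<in> M"
        using mn * ab by (intro M.a_closed M.I_r_closed[OF *(1)] M.I_r_closed[OF *(4)]
            M.I_r_closed[OF ab(3)]) auto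
      finally show False
        using M(3) S.m_closed[OF *(3,6)] by blast
    qed
  qed
  with M that show ?thesis by blast
qed

section \<open>The monoids of values of the nested expressions\<close>

text \<open>
  This is the iterated Krull boundary monoid of Coquand and Lombardi: localizing at the monoid of a
  one-element sequence \<open>x\<close> inverts \<open>x\<close> and every element congruent to \<open>1\<close> modulo \<open>x\<close>, which
  leaves exactly the primes from which \<open>x\<close> leads to a strictly larger one.
\<close>
definition boundary_monoid :: "('a, 'b) ring_scheme \<Rightarrow> 'a list \<Rightarrow> 'a set" where
  "boundary_monoid R xs =
     {pseudo_regular_expr R xs ms as | ms as.
        length as = length xs \<and> set as \<subseteq> carrier R \<and> length ms = length xs}"

lemma pseudo_regular_iff_boundary_monoid:
  "pseudo_regular R xs \<longleftrightarrow> set xs \<subseteq> carrier R \<and> \<zero>\<^bsub>R\<^esub> \<notin> boundary_monoid R xs"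
  unfolding pseudo_regular_def boundary_monoid_def by auto metis+

lemma boundary_monoid_Nil [simp]: "boundary_monoid R [] = {\<one>\<^bsub>R\<^esub>}"
  by (auto simp: boundary_monoid_def)

lemma boundary_monoid_Cons:
  "boundary_monoid R (x # xs) =
     {(x [^]\<^bsub>R\<^esub> m) \<otimes>\<^bsub>R\<^esub> (s \<oplus>\<^bsub>R\<^esub> a \<otimes>\<^bsub>R\<^esub> x) | (m :: nat) s a.
        s \<in> boundary_monoid R xs \<and> a \<in> carrier R}" (is "?L = ?R")
proof
  show "?L \<subseteq> ?R"
  proof
    fix y assume "y \<in> ?L"
    then obtain ms as where *: "y = pseudo_regular_expr R (x # xs) ms as"
      "length as = Suc (length xs)" "set as \<subseteq> carrier R" "length ms = Suc (length xs)"
      by (auto simp: boundary_monoid_def)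
    then obtain m ms' a as' where "ms = m # ms'" "as = a # as'"
      by (metis length_Suc_conv)
    with * show "y \<in> ?R"
      unfolding boundary_monoid_def by auto blast
  qed
  show "?R \<subseteq> ?L"
  proof
    fix y assume "y \<in> ?R"
    then obtain m a ms as where
      "y = pseudo_regular_expr R (x # xs) (m # ms) (a # as)"
      "length as = length xs" "set (a # as) \<subseteq> carrier R" "length ms = length xs"
      by (auto simp: boundary_monoid_def)
    then show "y \<in> ?L"
      unfolding boundary_monoid_def by fastforce
  qed
qed

lemma (in cring) submonoid_boundary_monoid:
  assumes "set xs \<subseteq> carrier R"
  shows "submonoid (boundary_monoid R xs) R"
  using assms
proof (induction xs)
  case Nil
  show ?case by unfold_locales auto
next
  case (Cons x xs)
  then have [simp]: "x \<in> carrier R" by simp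
  interpret S: submonoid "boundary_monoid R xs" R
    using Cons by simp
  show ?case
  proof
    show "boundary_monoid R (x # xs) \<subseteq> carrier R"
      by (auto simp: boundary_monoid_Cons)
    have "\<one> = x [^] (0 :: nat) \<otimes> (\<one> \<oplus> \<zero> \<otimes> x)"
      by simp
    then show "\<one> \<in> boundary_monoid R (x # xs)"
      unfolding boundary_monoid_Cons using S.one_closed zero_closed by blast
    fix y z assume "y \<in> boundary_monoid R (x # xs)" "z \<in> boundary_monoid R (x # xs)"
    then obtain m s a n t b where
      y: "y = x [^] (m :: nat) \<otimes> (s \<oplus> a \<otimes> x)" "s \<in> boundary_monoid R xs" "a \<in> carrier R" and
      z: "z = x [^] (n :: nat) \<otimes> (t \<oplus> b \<otimes> x)" "t \<in> boundary_monoid R xs" "b \<in> carrier R"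
      by (auto simp: boundary_monoid_Cons)
    have [simp]: "s \<in> carrier R" "t \<in> carrier R"
      using y z by auto
    have "y \<otimes> z = (x [^] m \<otimes> x [^] n) \<otimes> ((s \<oplus> a \<otimes> x) \<otimes> (t \<oplus> b \<otimes> x))"
      using y(3) z(3) unfolding y(1) z(1) by (simp add: m_ac)
    also have "(s \<oplus> a \<otimes> x) \<otimes> (t \<oplus> b \<otimes> x)
      = s \<otimes> t \<oplus> (s \<otimes> b \<oplus> a \<otimes> t \<oplus> a \<otimes> b \<otimes> x) \<otimes> x"
      using y(3) z(3) \<open>s \<in> carrier R\<close> \<open>t \<in> carrier R\<close> \<open>x \<in> carrier R\<close> by algebra
    also have "x [^] m \<otimes> x [^] n = x [^] (m + n)"
      by (simp add: nat_pow_mult)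
    finally show "y \<otimes> z \<in> boundary_monoid R (x # xs)"
      unfolding boundary_monoid_Cons using y z by (blast intro: S.m_closed a_closed m_closed
          \<open>s \<in> carrier R\<close> \<open>t \<in> carrier R\<close> \<open>x \<in> carrier R\<close>)
  qed
qed

lemma (in primeideal) nat_pow_mem_imp:
  assumes "x \<in> carrier R" "x [^] (m :: nat) \<in> I"
  shows "x \<in> I"
  using assms(2)
proof (induction m)
  case 0
  then show ?case using one_imp_carrier I_notcarr by simp
next
  case (Suc m)
  then show ?case using I_prime[of "x [^] m" x] assms(1) by auto
qed

section \<open>From prime chains to pseudo regular sequences and back\<close>

text \<open>
  The induction runs from the top of the chain downwards: the tail of the sequence is treated with
  the chain that starts at \<open>P 1\<close>, and \<open>x \<in> P 1 - P 0\<close> carries the disjointness down to \<open>P 0\<close>.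
\<close>
lemma (in cring) boundary_monoid_disjoint_chain:
  assumes "\<And>i. i \<le> length xs \<Longrightarrow> primeideal (P i) R"
    and "\<And>i. i < length xs \<Longrightarrow> P i \<subseteq> P (Suc i)"
    and "\<And>i. i < length xs \<Longrightarrow> xs ! i \<in> P (Suc i) - P i"
  shows "P 0 \<inter> boundary_monoid R xs = {}"
  using assms
proof (induction xs arbitrary: P)
  case Nil
  then interpret primeideal "P 0" R by simp
  show ?case
    using one_imp_carrier I_notcarr by auto
next
  case (Cons x xs)
  interpret P: primeideal "P 0" R using Cons.prems(1)[of 0] by simp
  interpret Q: primeideal "P (Suc 0)" R using Cons.prems(1)[of 1] by simp
  have IH: "P (Suc 0) \<inter> boundary_monoid R xs = {}"
    using Cons.prems(1,2) Cons.prems(3)[of "Suc _"]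
    by (intro Cons.IH[of "\<lambda>i. P (Suc i)"]) auto
  have x: "x \<in> P (Suc 0)" "x \<notin> P 0" and PQ: "P 0 \<subseteq> P (Suc 0)"
    using Cons.prems(2,3)[of 0] by auto
  have xc: "x \<in> carrier R"
    using x(1) Q.Icarr by blast
  have "set xs \<subseteq> carrier R"
  proof
    fix y assume "y \<in> set xs"
    then obtain i where "i < length xs" "y = xs ! i"
      by (auto simp: in_set_conv_nth)
    then have "y \<in> P (Suc (Suc i))" "ideal (P (Suc (Suc i))) R"
      using Cons.prems(3)[of "Suc i"] Cons.prems(1)[of "Suc (Suc i)"] primeideal.axioms(1) by auto
    then show "y \<in> carrier R"
      using ideal.Icarr by metis
  qed
  then interpret S: submonoid "boundary_monoid R xs" R
    by (rule submonoid_boundary_monoid)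
  have False if y: "x [^] m \<otimes> (s \<oplus> a \<otimes> x) \<in> P 0"
    and s: "s \<in> boundary_monoid R xs" and a: "a \<in> carrier R" for m :: nat and s a
  proof -
    have sc: "s \<in> carrier R" using s by auto
    have "x [^] m \<notin> P 0"
      using P.nat_pow_mem_imp x(2) xc by blast
    then have sum: "s \<oplus> a \<otimes> x \<in> P (Suc 0)"
      using P.I_prime[OF _ _ y] sc a xc PQ by auto
    have "a \<otimes> x \<in> P (Suc 0)"
      using x(1) a by (rule Q.I_l_closed)
    from Q.a_closed[OF sum Q.a_inv_closed[OF this]]
    have "(s \<oplus> a \<otimes> x) \<oplus> \<ominus> (a \<otimes> x) \<in> P (Suc 0)" .
    also have "(s \<oplus> a \<otimes> x) \<oplus> \<ominus> (a \<otimes> x) = s"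
      using sc a xc by algebra
    finally show False
      using IH s by blast
  qed
  then show ?case
    by (auto simp: boundary_monoid_Cons)
qed

text \<open>
  The induction over the sequence needs an arbitrary ideal \<open>I\<close> in place of the zero ideal, since the
  primes after the first one must contain \<open>P + x A\<close>.
\<close>
lemma (in cring) prime_chain_of_disjoint:
  assumes "set xs \<subseteq> carrier R" "ideal I R" "I \<inter> boundary_monoid R xs = {}"
  shows "\<exists>P. I \<subseteq> P 0 \<and> (\<forall>i\<le>length xs. primeideal (P i) R) \<and> (\<forall>i<length xs. P i \<subset> P (Suc i))"
  using assms
proof (induction xs arbitrary: I)
  case Nil
  then obtain P where "primeideal P R" "I \<subseteq> P"
    using prime_ideal_avoiding[OF _ submonoid_boundary_monoid] by metis
  then show ?case
    by (intro exI[of _ "\<lambda>_. P"]) simp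
next
  case (Cons x xs)
  then have xc: "x \<in> carrier R" and xs: "set xs \<subseteq> carrier R" by auto
  interpret S: submonoid "boundary_monoid R xs" R
    using xs by (rule submonoid_boundary_monoid)
  obtain P where P: "primeideal P R" "I \<subseteq> P" "P \<inter> boundary_monoid R (x # xs) = {}"
    using Cons.prems prime_ideal_avoiding[OF _ submonoid_boundary_monoid] by metis
  interpret P: primeideal P R by (fact P(1))
  have "x = x [^] (1 :: nat) \<otimes> (\<one> \<oplus> \<zero> \<otimes> x)"
    using xc by simp
  then have "x \<in> boundary_monoid R (x # xs)"
    unfolding boundary_monoid_Cons using S.one_closed zero_closed by blast
  then have xP: "x \<notin> P" using P(3) by blast
  have "(P <+>\<^bsub>R\<^esub> PIdl x) \<inter> boundary_monoid R xs = {}"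
  proof (intro equals0I, elim IntE)
    fix s assume s: "s \<in> P <+>\<^bsub>R\<^esub> PIdl x" "s \<in> boundary_monoid R xs"
    obtain p a where p: "p \<in> P" "a \<in> carrier R" "s = p \<oplus> a \<otimes> x"
      using s(1) by (rule mem_add_PIdl)
    \<comment> \<open>Exponent \<open>0\<close>: the monoid contains \<open>s + x A\<close> itself, and \<open>p\<close> lies in it.\<close>
    have "p = x [^] (0 :: nat) \<otimes> (s \<oplus> (\<ominus> a) \<otimes> x)"
      using p(2) P.Icarr[OF p(1)] xc unfolding p(3) nat_pow_0 by algebra
    then have "p \<in> boundary_monoid R (x # xs)"
      unfolding boundary_monoid_Cons using s(2) p(2) a_inv_closed by blast
    with p(1) P(3) show False by blast
  qed
  then obtain Q where Q: "P <+>\<^bsub>R\<^esub> PIdl x \<subseteq> Q 0" "\<And>i. i \<le> length xs \<Longrightarrow> primeideal (Q i) R"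
    "\<And>i. i < length xs \<Longrightarrow> Q i \<subset> Q (Suc i)"
    using Cons.IH[OF xs add_ideals[OF P.is_ideal cgenideal_ideal[OF xc]]] by blast
  have "P \<subset> Q 0"
    using Q(1) subset_add_PIdl[OF P.is_ideal xc] xP by blast
  then show ?case
    using P Q(2,3) by (intro exI[of _ "case_nat P Q"]) (auto split: nat.split)
qed

theorem mainTheorem6:
  fixes R :: "('a, 'b) ring_scheme" and l :: nat
  assumes "cring R" and "l \<ge> 1"
  shows "krull_dim_ge R l \<longleftrightarrow> (\<exists>xs. length xs = l \<and> pseudo_regular R xs)"
proof
  interpret cring R by (fact assms(1))
  show "\<exists>xs. length xs = l \<and> pseudo_regular R xs" if dim: "krull_dim_ge R l"
  proof -
    obtain P where P: "\<And>i. i \<le> l \<Longrightarrow> primeideal (P i) R" "\<And>i. i < l \<Longrightarrow> P i \<subset> P (Suc i)"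
      using dim unfolding krull_dim_ge_def by blast
    from P(2) have "\<forall>i\<in>{..<l}. \<exists>x. x \<in> P (Suc i) - P i"
      by blast
    then obtain f where f: "\<And>i. i < l \<Longrightarrow> f i \<in> P (Suc i) - P i"
      by (metis lessThan_iff)
    define xs where "xs = map f [0..<l]"
    have "P 0 \<inter> boundary_monoid R xs = {}"
      using P f by (intro boundary_monoid_disjoint_chain) (auto simp: xs_def)
    moreover have "\<zero>\<^bsub>R\<^esub> \<in> P 0"
      using P(1)[of 0] by (simp add: additive_subgroup.zero_closed ideal.axioms(1) primeideal.axioms(1))
    moreover have "f i \<in> carrier R" if "i < l" for i
      using f[OF that] P(1)[of "Suc i"] that ideal.Icarr primeideal.axioms(1) by fastforce
    then have "set xs \<subseteq> carrier R"
      by (auto simp: xs_def)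
    ultimately have "pseudo_regular R xs"
      by (auto simp: pseudo_regular_iff_boundary_monoid)
    moreover have "length xs = l"
      by (simp add: xs_def)
    ultimately show ?thesis by blast
  qed
  show "krull_dim_ge R l" if seq: "\<exists>xs. length xs = l \<and> pseudo_regular R xs"
  proof -
    obtain xs where xs: "length xs = l" "pseudo_regular R xs"
      using seq by blast
    then show ?thesis
      using prime_chain_of_disjoint[OF _ zeroideal, of xs]
      unfolding krull_dim_ge_def pseudo_regular_iff_boundary_monoid by auto
  qed
qed

end
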